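(* Let $A\in\mathbb{R}^{n\times n}$ be symmetric positive definite with spectral decomposition $A=V\Lambda V^T+V_\perp\Lambda_\perp V_\perp^T$, where $(V,V_\perp)$ is an orthogonal matrix, $V\in\mathbb{R}^{n\times r}$, $\Lambda=\mathrm{diag}(\lambda_1,\dots,\lambda_r)$, $\Lambda_\perp=\mathrm{diag}(\lambda_{r+1},\dots,\lambda_n)$, $1\le r<n$, and every diagonal entry of $\Lambda$ is at most every diagonal entry of $\Lambda_\perp$. Let $\tilde E=V^TAV$ and let $\tilde H\in\mathbb{R}^{r\times r}$ be an invertible matrix. Let $\bar P_A=I-AV\tilde H^{-1}V^T+V\tilde H^{-1}V^T$, $\rho_1=\tilde E\tilde H^{-1}-I$ and $\rho_2=\tilde H^{-1}\tilde E-I$. If the eigenvalues of $\bar P_AA$ are real, then $$\lambda_{\max}(\bar P_AA)\le\max\{1,\lambda_{\max}(\Lambda_\perp)\}+\xi_A,$$ $$\lambda_{\min}(\bar P_AA)\ge\min\{1,\lambda_{\min}(\Lambda_\perp)\}-\xi_A,$$ where $\xi_A=\|\rho_1\|_2\|\Lambda\|_2+\|\rho_2\|_2$.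
   Context: $\|\cdot\|_2$ is the spectral norm; $\lambda_{\min}$ and $\lambda_{\max}$ denote the smallest and largest eigenvalues of a matrix with real eigenvalues. The matrix $\tilde H$ is thought of as an approximation to $\tilde E$. *)

theory Defs
  imports "HOL-Analysis.Analysis"
begin

definition symmetric_positive_definite :: "real^'n^'n \<Rightarrow> bool" where
  "symmetric_positive_definite A \<longleftrightarrow>
     transpose A = A \<and> (\<forall>x. x \<noteq> 0 \<longrightarrow> x \<bullet> (A *v x) > 0)"

definition diag_matrix :: "('n \<Rightarrow> real) \<Rightarrow> real^'n^'n" where
  "diag_matrix d = (\<chi> i j. if i = j then d i else 0)"

text \<open>The block matrix \<open>(V, W)\<close>: the columns of \<open>V\<close> (indexed by \<open>Inl\<close>) followed by those of
  \<open>W\<close> (indexed by \<open>Inr\<close>).\<close>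

definition block_cols :: "real^'r^'n \<Rightarrow> real^'s^'n \<Rightarrow> real^('r + 's)^'n" where
  "block_cols V W = (\<chi> i k. case k of Inl j \<Rightarrow> V $ i $ j | Inr j \<Rightarrow> W $ i $ j)"

text \<open>The library constant \<open>orthogonal_matrix\<close> requires rows and columns to share one index type.
  Here the two index types may differ, but the two equations together force them to have the same
  cardinality, so an orthogonal matrix is still square.\<close>

definition orthogonal_mat :: "real^'m^'n \<Rightarrow> bool" where
  "orthogonal_mat Q \<longleftrightarrow> transpose Q ** Q = mat 1 \<and> Q ** transpose Q = mat 1"

definition complex_mat :: "real^'m^'n \<Rightarrow> complex^'m^'n" where
  "complex_mat M = (\<chi> i j. complex_of_real (M $ i $ j))"

text \<open>The complex eigenvalues of a real square matrix.\<close>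

definition eigenvalues :: "real^'n^'n \<Rightarrow> complex set" where
  "eigenvalues M = {z. \<exists>v. v \<noteq> 0 \<and> complex_mat M *v v = z *s v}"

definition real_eigenvalues :: "real^'n^'n \<Rightarrow> bool" where
  "real_eigenvalues M \<longleftrightarrow> eigenvalues M \<subseteq> \<real>"

text \<open>Largest and smallest eigenvalue; meaningful for matrices all of whose eigenvalues are real
  (then the set below is the whole spectrum, which is finite and nonempty).\<close>

definition lambda_max :: "real^'n^'n \<Rightarrow> real" where
  "lambda_max M = Max {x. complex_of_real x \<in> eigenvalues M}"

definition lambda_min :: "real^'n^'n \<Rightarrow> real" where
  "lambda_min M = Min {x. complex_of_real x \<in> eigenvalues M}"

text \<open>The operator norm induced by the Euclidean norms.\<close>

definition spectral_norm :: "real^'m^'n \<Rightarrow> real" where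
  "spectral_norm M = onorm (\<lambda>x. M *v x)"

end

theory Submission
  imports Defs
begin

text \<open>Since \<open>A V = V \<Lambda>\<close>, we have \<open>E = \<Lambda>\<close> and, in the orthonormal basis \<open>(V, V\<^sub>\<bottom>)\<close>, the matrix
  \<open>P A\<close> is block diagonal with blocks \<open>I - \<rho>\<^sub>1 \<Lambda> + \<rho>\<^sub>2\<close> and \<open>\<Lambda>\<^sub>\<bottom>\<close>. An eigenvalue of the first block
  is within \<open>\<xi>\<close> of \<open>1\<close>.\<close>

lemma matrix_add_rdistrib:
  fixes A B :: "real^'n^'m" and C :: "real^'k^'n"
  shows "(A + B) ** C = A ** C + B ** C"
  by (simp add: matrix_matrix_mult_def vec_eq_iff sum.distrib algebra_simps)

lemma matrix_sub_ldistrib: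
  fixes A :: "real^'n^'m" and B C :: "real^'k^'n"
  shows "A ** (B - C) = A ** B - A ** C"
  by (simp add: matrix_matrix_mult_def vec_eq_iff sum_subtractf algebra_simps)

lemma matrix_sub_rdistrib:
  fixes A B :: "real^'n^'m" and C :: "real^'k^'n"
  shows "(A - B) ** C = A ** C - B ** C"
  by (simp add: matrix_matrix_mult_def vec_eq_iff sum_subtractf algebra_simps)

text \<open>For rewriting with a known product that sits inside a longer one: this rule serves
  products nested to the left, the next one products nested to the right.\<close>

lemma matrix_mult_eq_left:
  fixes A :: "real^'n^'m" and B :: "real^'k^'n"
  assumes "A ** B = C"
  shows "X ** A ** B = X ** C"
  using assms by (simp flip: matrix_mul_assoc)

lemma matrix_mult_eq_right:
  fixes A :: "real^'n^'m" and B :: "real^'k^'n"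
  assumes "A ** B = C"
  shows "A ** (B ** X) = C ** X"
  using assms by (simp add: matrix_mul_assoc)

text \<open>A real matrix acts separately on real and imaginary parts. For real \<open>x\<close>
  both parts of a complex eigenvector satisfy the same equation, and at least one of them is
  nonzero; conversely a real eigenvector embeds into the complex space. From here on only real
  vectors occur.\<close>

lemma real_eigenvalue_iff:
  fixes M :: "real^'n^'n"
  shows "complex_of_real x \<in> eigenvalues M \<longleftrightarrow> (\<exists>v. v \<noteq> 0 \<and> M *v v = x *s v)"
proof
  assume "complex_of_real x \<in> eigenvalues M"
  then obtain v where v: "v \<noteq> 0" "complex_mat M *v v = complex_of_real x *s v"
    by (auto simp: eigenvalues_def)
  define a b where "a = (\<chi> i. Re (v $ i))" and "b = (\<chi> i. Im (v $ i))"
  have *: "(\<Sum>j\<in>UNIV. complex_of_real (M $ i $ j) * v $ j) = complex_of_real x * v $ i" for i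
    using arg_cong[OF v(2), of "\<lambda>w. w $ i"] by (simp add: matrix_vector_mult_def complex_mat_def)
  have "M *v a = x *s a"
    using arg_cong[OF *, of Re] by (simp add: vec_eq_iff matrix_vector_mult_def a_def)
  moreover have "M *v b = x *s b"
    using arg_cong[OF *, of Im] by (simp add: vec_eq_iff matrix_vector_mult_def b_def)
  moreover have "a \<noteq> 0 \<or> b \<noteq> 0"
    using v(1) by (auto simp: vec_eq_iff a_def b_def complex_eq_iff)
  ultimately show "\<exists>v. v \<noteq> 0 \<and> M *v v = x *s v"
    by blast
next
  assume "\<exists>v. v \<noteq> 0 \<and> M *v v = x *s v"
  then obtain v where v: "v \<noteq> 0" "M *v v = x *s v"
    by blast
  define w where "w = (\<chi> i. complex_of_real (v $ i))"
  have "w \<noteq> 0"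
    using v(1) by (auto simp: vec_eq_iff w_def)
  moreover have "(\<Sum>j\<in>UNIV. M $ i $ j * v $ j) = x * v $ i" for i
    using arg_cong[OF v(2), of "\<lambda>w. w $ i"] by (simp add: matrix_vector_mult_def)
  then have "complex_mat M *v w = complex_of_real x *s w"
    by (simp add: vec_eq_iff matrix_vector_mult_def complex_mat_def w_def
        flip: of_real_mult of_real_sum)
  ultimately show "complex_of_real x \<in> eigenvalues M"
    by (auto simp: eigenvalues_def)
qed

lemma norm_matrix_vector_le_spectral_norm: "norm (M *v v) \<le> spectral_norm M * norm v"
  unfolding spectral_norm_def by (rule onorm) simp

lemma spectral_norm_nonneg: "0 \<le> spectral_norm M"
  unfolding spectral_norm_def by (rule onorm_pos_le) simp

lemma abs_eigenvalue_le_spectral_norm: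
  fixes M :: "real^'n^'n"
  assumes "M *v v = x *s v" "v \<noteq> 0"
  shows "\<bar>x\<bar> \<le> spectral_norm M"
  using norm_matrix_vector_le_spectral_norm[of M v] assms
  by (simp add: scalar_mult_eq_scaleR)

text \<open>In the Leibniz expansion every factor is constant or linear in \<open>x\<close>, so each
  product over a permutation is a polynomial.\<close>

lemma det_shift_eq_poly:
  fixes M :: "real^'n^'n"
  shows "\<exists>p. \<forall>x. det (M - mat x) = poly p x"
proof -
  define p where "p = (\<Sum>\<sigma> | \<sigma> permutes (UNIV :: 'n set).
    smult (of_int (sign \<sigma>)) (\<Prod>i\<in>UNIV. [:M $ i $ \<sigma> i, if i = \<sigma> i then -1 else 0:]))"
  have "det (M - mat x) = poly p x" for x
    by (auto simp: det_def p_def poly_sum poly_prod mat_def intro!: sum.cong prod.cong)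
  then show ?thesis
    by blast
qed

lemma finite_real_eigenvalues:
  fixes M :: "real^'n^'n"
  shows "finite {x. complex_of_real x \<in> eigenvalues M}"
proof -
  obtain p where p: "\<And>x. det (M - mat x) = poly p x"
    using det_shift_eq_poly[of M] by blast
  have root: "complex_of_real x \<in> eigenvalues M \<longleftrightarrow> poly p x = 0" for x
  proof -
    have "mat x *v v = x *s v" for v :: "real^'n"
      by (simp add: vec_eq_iff matrix_vector_mult_def mat_def if_distrib if_distribR cong: if_cong)
    then have "(M - mat x) *v v = 0 \<longleftrightarrow> M *v v = x *s v" for v
      by (simp add: matrix_vector_mult_diff_rdistrib)
    moreover have "det (M - mat x) = 0 \<longleftrightarrow> (\<exists>v. v \<noteq> 0 \<and> (M - mat x) *v v = 0)"
      by (metis invertible_det_nz invertible_left_inverse matrix_left_invertible_ker)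
    ultimately show ?thesis
      by (simp add: real_eigenvalue_iff p)
  qed
  \<comment> \<open>Finitely many roots require \<open>p\<close> to be nonzero. A point beyond the
    spectral norm cannot be an eigenvalue, which shows this without computing a leading
    coefficient.\<close>
  have "poly p (spectral_norm M + 1) \<noteq> 0"
  proof
    assume "poly p (spectral_norm M + 1) = 0"
    then have "\<bar>spectral_norm M + 1\<bar> \<le> spectral_norm M"
      using root real_eigenvalue_iff abs_eigenvalue_le_spectral_norm by metis
    then show False
      by simp
  qed
  then have "p \<noteq> 0"
    by auto
  then show ?thesis
    by (simp add: root poly_roots_finite)
qed

lemma le_lambda_max:
  "complex_of_real x \<in> eigenvalues M \<Longrightarrow> x \<le> lambda_max M"
  unfolding lambda_max_def by (rule Max_ge) (auto simp: finite_real_eigenvalues)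

lemma lambda_min_le:
  "complex_of_real x \<in> eigenvalues M \<Longrightarrow> lambda_min M \<le> x"
  unfolding lambda_min_def by (rule Min_le) (auto simp: finite_real_eigenvalues)

text \<open>The assumed eigenvalue serves only as a witness that the set under \<open>Max\<close> is
  nonempty, so that the maximum is attained.\<close>

lemma lambda_max_in_eigenvalues:
  assumes "complex_of_real x \<in> eigenvalues M"
  shows "complex_of_real (lambda_max M) \<in> eigenvalues M"
  using Max_in[OF finite_real_eigenvalues[of M]] assms unfolding lambda_max_def by blast

lemma lambda_min_in_eigenvalues:
  assumes "complex_of_real x \<in> eigenvalues M"
  shows "complex_of_real (lambda_min M) \<in> eigenvalues M"
  using Min_in[OF finite_real_eigenvalues[of M]] assms unfolding lambda_min_def by blast

text \<open>The first four equations are the blocks of \<open>transpose Q ** Q = mat 1\<close>. The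
  last is \<open>Q ** transpose Q = mat 1\<close>, with the sum over columns split into its
  \<open>Inl\<close> and \<open>Inr\<close> halves.\<close>

lemma orthogonal_mat_block_cols:
  assumes "orthogonal_mat (block_cols V W)"
  shows "transpose V ** V = mat 1" "transpose W ** W = mat 1"
    "transpose V ** W = 0" "transpose W ** V = 0"
    "V ** transpose V + W ** transpose W = mat 1"
proof -
  let ?Q = "block_cols V W"
  have inner: "(\<Sum>i\<in>UNIV. ?Q $ i $ k * ?Q $ i $ l) = (if k = l then 1 else 0)" for k l
    using assms unfolding orthogonal_mat_def
    by (simp add: vec_eq_iff matrix_matrix_mult_def transpose_def mat_def)
  show "transpose V ** V = mat 1"
    using inner[of "Inl _" "Inl _"]
    by (simp add: vec_eq_iff matrix_matrix_mult_def transpose_def mat_def block_cols_def)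
  show "transpose W ** W = mat 1"
    using inner[of "Inr _" "Inr _"]
    by (simp add: vec_eq_iff matrix_matrix_mult_def transpose_def mat_def block_cols_def)
  show "transpose V ** W = 0"
    using inner[of "Inl _" "Inr _"]
    by (simp add: vec_eq_iff matrix_matrix_mult_def transpose_def mat_def block_cols_def)
  show "transpose W ** V = 0"
    using inner[of "Inr _" "Inl _"]
    by (simp add: vec_eq_iff matrix_matrix_mult_def transpose_def mat_def block_cols_def)
  have "?Q ** transpose ?Q = V ** transpose V + W ** transpose W"
    by (simp add: vec_eq_iff matrix_matrix_mult_def transpose_def block_cols_def
        UNIV_Plus_UNIV[symmetric] sum.Plus del: UNIV_Plus_UNIV)
  then show "V ** transpose V + W ** transpose W = mat 1"
    using assms unfolding orthogonal_mat_def by simp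
qed

text \<open>Moving \<open>v\<close> to the other side leaves
  \<open>(x - 1) *s v = R2 *v v - R1 *v (L *v v)\<close>; take norms and cancel
  \<open>norm v\<close>.\<close>

lemma eigenvalue_near_one:
  fixes R1 R2 L :: "real^'r^'r"
  assumes "(mat 1 - R1 ** L + R2) *v v = x *s v" "v \<noteq> 0"
  shows "\<bar>x - 1\<bar> \<le> spectral_norm R1 * spectral_norm L + spectral_norm R2"
proof -
  have "\<bar>x - 1\<bar> * norm v = norm ((x - 1) *s v)"
    by (simp add: scalar_mult_eq_scaleR)
  also have "(x - 1) *s v = R2 *v v - R1 *v (L *v v)"
    using assms(1)
    by (simp add: matrix_vector_mult_add_rdistrib matrix_vector_mult_diff_rdistrib
        matrix_vector_mul_assoc vec_eq_iff algebra_simps)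
  also have "norm \<dots> \<le> norm (R2 *v v) + norm (R1 *v (L *v v))"
    by (rule norm_triangle_ineq4)
  also have "norm (R1 *v (L *v v)) \<le> spectral_norm R1 * norm (L *v v)"
    by (rule norm_matrix_vector_le_spectral_norm)
  also have "\<dots> \<le> spectral_norm R1 * (spectral_norm L * norm v)"
    by (intro mult_left_mono norm_matrix_vector_le_spectral_norm spectral_norm_nonneg)
  also have "norm (R2 *v v) \<le> spectral_norm R2 * norm v"
    by (rule norm_matrix_vector_le_spectral_norm)
  finally have "\<bar>x - 1\<bar> * norm v
      \<le> (spectral_norm R1 * spectral_norm L + spectral_norm R2) * norm v"
    by (simp add: algebra_simps)
  then show ?thesis
    using assms(2) by simp
qed

theorem theorem4p3:
  fixes A P :: "real^'n^'n"
    and V :: "real^'r^'n" and Vp :: "real^'s^'n"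
    and lam :: "'r \<Rightarrow> real" and lamp :: "'s \<Rightarrow> real"
    and Lam E H \<rho>1 \<rho>2 :: "real^'r^'r" and Lamp :: "real^'s^'s"
    and \<xi> :: real
  assumes "symmetric_positive_definite A"
    and "orthogonal_mat (block_cols V Vp)"
    and "Lam = diag_matrix lam" and "Lamp = diag_matrix lamp"
    and "A = V ** Lam ** transpose V + Vp ** Lamp ** transpose Vp"
    and "\<forall>i j. lam i \<le> lamp j"
    and "E = transpose V ** A ** V"
    and "invertible H"
    and "P = mat 1 - A ** V ** matrix_inv H ** transpose V + V ** matrix_inv H ** transpose V"
    and "\<rho>1 = E ** matrix_inv H - mat 1"
    and "\<rho>2 = matrix_inv H ** E - mat 1"
    and "real_eigenvalues (P ** A)"
    and "\<xi> = spectral_norm \<rho>1 * spectral_norm Lam + spectral_norm \<rho>2"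
  shows "lambda_max (P ** A) \<le> max 1 (lambda_max Lamp) + \<xi> \<and>
         lambda_min (P ** A) \<ge> min 1 (lambda_min Lamp) - \<xi>"
proof -
  let ?Hi = "matrix_inv H" and ?M = "mat 1 - \<rho>1 ** Lam + \<rho>2"
  note orth = orthogonal_mat_block_cols[OF assms(2)]
  note blocks = orth orth(1-4)[THEN matrix_mult_eq_left] orth(1-4)[THEN matrix_mult_eq_right]
  have VA: "transpose V ** A = Lam ** transpose V"
    using blocks by (simp add: assms(5) matrix_add_ldistrib matrix_mul_assoc)
  have WA: "transpose Vp ** A = Lamp ** transpose Vp"
    using blocks by (simp add: assms(5) matrix_add_ldistrib matrix_mul_assoc)
  have AV: "A ** V = V ** Lam"
    using blocks by (simp add: assms(5) matrix_add_rdistrib flip: matrix_mul_assoc)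
  have AW: "A ** Vp = Vp ** Lamp"
    using blocks by (simp add: assms(5) matrix_add_rdistrib flip: matrix_mul_assoc)
  have E: "E = Lam"
    using blocks by (simp add: assms(7) VA flip: matrix_mul_assoc)
  \<comment> \<open>With \<open>A ** V = V ** Lam\<close> the correction to the identity starts and
    ends in the range of \<open>V\<close>, so \<open>P\<close> fixes the range of \<open>Vp\<close>,
    and \<open>transpose Vp ** P = transpose Vp\<close>.\<close>
  have P: "P = mat 1 - V ** (Lam ** ?Hi - ?Hi) ** transpose V"
    by (simp add: assms(9) AV matrix_sub_ldistrib matrix_sub_rdistrib matrix_mul_assoc)
  have VP: "transpose V ** P = (mat 1 - Lam ** ?Hi + ?Hi) ** transpose V"
    using blocks by (simp add: P matrix_sub_ldistrib matrix_sub_rdistrib matrix_add_rdistrib matrix_mul_assoc)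
  have VPA: "transpose V ** (P ** A) = ?M ** transpose V"
  proof -
    have "transpose V ** (P ** A) = (mat 1 - Lam ** ?Hi + ?Hi) ** Lam ** transpose V"
      by (metis VP VA matrix_mul_assoc)
    \<comment> \<open>Since \<open>E = Lam\<close>, both sides expand to
      \<open>Lam - Lam ** ?Hi ** Lam + ?Hi ** Lam\<close>; the identity in \<rho>2 cancels the
      leading \<open>mat 1\<close> of \<open>?M\<close>.\<close>
    also have "(mat 1 - Lam ** ?Hi + ?Hi) ** Lam = ?M"
      by (simp add: assms(10,11) E matrix_sub_rdistrib matrix_add_rdistrib)
    finally show ?thesis .
  qed
  have WPA: "transpose Vp ** (P ** A) = Lamp ** transpose Vp"
    using blocks by (simp add: P matrix_sub_ldistrib matrix_mul_assoc WA)
  have PAW: "(P ** A) ** Vp = Vp ** Lamp"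
  proof -
    have "P ** Vp = Vp"
      using blocks by (simp add: P matrix_sub_rdistrib flip: matrix_mul_assoc)
    then show ?thesis
      by (metis AW matrix_mul_assoc)
  qed
  have \<xi>: "0 \<le> \<xi>"
    by (simp add: assms(13) spectral_norm_nonneg)
  have bounds: "x \<le> max 1 (lambda_max Lamp) + \<xi> \<and> min 1 (lambda_min Lamp) - \<xi> \<le> x"
    if x: "complex_of_real x \<in> eigenvalues (P ** A)" for x
  proof -
    obtain v where v: "v \<noteq> 0" "(P ** A) *v v = x *s v"
      using x by (auto simp: real_eigenvalue_iff)
    \<comment> \<open>Each coordinate block of \<open>v\<close> satisfies the eigenvalue equation of
      its diagonal block; whichever block is nonzero is an eigenvector there and locates
      \<open>x\<close>.\<close>
    have M: "?M *v (transpose V *v v) = x *s (transpose V *v v)"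
      by (metis VPA matrix_vector_mul_assoc v(2) vector_scalar_commute)
    have L: "Lamp *v (transpose Vp *v v) = x *s (transpose Vp *v v)"
      by (metis WPA matrix_vector_mul_assoc v(2) vector_scalar_commute)
    show ?thesis
    proof (cases "transpose Vp *v v = 0")
      case True
      \<comment> \<open>Expanding \<open>v\<close> in the orthonormal basis shows that both
        coordinate blocks cannot vanish.\<close>
      have "v = V *v (transpose V *v v) + Vp *v (transpose Vp *v v)"
        using orth(5)
        by (simp add: matrix_vector_mul_assoc del: transpose_matrix_vector
            flip: matrix_vector_mult_add_rdistrib)
      with True v(1) have "transpose V *v v \<noteq> 0"
        by auto
      with M have "\<bar>x - 1\<bar> \<le> \<xi>"
        unfolding assms(13) by (rule eigenvalue_near_one)
      then show ?thesis
        by linarith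
    next
      case False
      with L have "complex_of_real x \<in> eigenvalues Lamp"
        by (auto simp: real_eigenvalue_iff)
      then have "x \<le> lambda_max Lamp" "lambda_min Lamp \<le> x"
        by (auto intro: le_lambda_max lambda_min_le)
      with \<xi> show ?thesis
        by linarith
    qed
  qed
  \<comment> \<open>This makes the set of real eigenvalues of \<open>P ** A\<close> nonempty, so its
    \<open>Max\<close> and \<open>Min\<close> are themselves eigenvalues and \<open>bounds\<close>
    applies to them. The eigenvector is column \<open>j\<close> of \<open>Vp\<close>.\<close>
  have PA_eig: "complex_of_real (lamp j) \<in> eigenvalues (P ** A)" for j
  proof -
    let ?e = "axis j 1 :: real^'s" and ?v = "Vp *v (axis j 1 :: real^'s)"
    have "transpose Vp *v ?v = ?e"
      using orth(2) by (simp add: matrix_vector_mul_assoc del: transpose_matrix_vector)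
    then have "?v \<noteq> 0"
      by (metis axis_eq_0_iff matrix_vector_mult_0_right zero_neq_one)
    moreover have "Lamp *v ?e = lamp j *s ?e"
      unfolding matrix_vector_mult_basis
      by (simp add: assms(4) vec_eq_iff diag_matrix_def column_def axis_def)
    then have "(P ** A) *v ?v = lamp j *s ?v"
      by (metis PAW matrix_vector_mul_assoc vector_scalar_commute)
    ultimately show ?thesis
      by (auto simp: real_eigenvalue_iff)
  qed
  show ?thesis
    using bounds[OF lambda_max_in_eigenvalues[OF PA_eig]] bounds[OF lambda_min_in_eigenvalues[OF PA_eig]]
    by simp
qed

end
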